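(* Let the data distribution $\pi^*$ fulfill $d\,\Pi_n^*\le\sigma_n^2$ for a constant $d>0$ and all $n\in\mathbb{N}$. Let $\delta\mapsto\mu(\delta)$, $\delta\in(0,\infty)$, be an a-priori choice of training noise, where each $\mu(\delta)$ is a noise distribution on $X$ for which $R^{\mathrm{post}}_{\mu(\delta)}:Y\to X$ is continuous, with $\boldsymbol{\delta}(\mu(\delta))=\delta$ for all $\delta>0$ and $$\tilde\Delta_n(\mu(\delta))\ge\delta^2\,\ell(n)\quad\text{for all }n\in\mathbb{N},\ \delta>0,$$ with a uniform lower bound $\ell:\mathbb{N}\to[0,\infty)$ (independent of $\delta$). For $c>0$ let $$\Phi^2_c=\{\nu\mid\Delta_n(\nu)\le c\cdot\ell(n)^2\text{ for all }n\in\mathbb{N}\},$$ where $\nu$ ranges over noise distributions on $Y$. Then for every $x\in N(A)^\perp$ and every $c>0$, $$\sup_{\nu\in\delta^2\cdot\Phi^2_c}\mathbb{E}_{\epsilon\sim\nu}\left[\left\|R^{\mathrm{post}}_{\mu(\delta)}(Ax+\epsilon)-x\right\|^2\right]\longrightarrow0\quad\text{as }\delta\to0.$$ Moreover, if the training noise is white, i.e. $\tilde\Delta_n(\mu(\delta))=\delta^2$ for all $n\in\mathbb{N}$ and $\delta>0$, then for every $x\in N(A)^\perp$, $$\sup_{\nu\in\Psi,\ \boldsymbol{\delta}(\nu)\le\delta^2}\mathbb{E}_{\epsilon\sim\nu}\left[\left\|R^{\mathrm{post}}_{\mu(\delta)}(Ax+\epsilon)-x\right\|^2\right]\longrightarrow0\quad\text{as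 }\delta\to0,$$ where $\Psi$ is the set of noise distributions $\nu$ on $Y$ for which $R^{\mathrm{mse}}_\nu:Y\to X$ is continuous.
   Context: $X,Y$ are (real) infinite-dimensional Hilbert spaces and $A:X\to Y$ is a compact linear operator with infinite-dimensional range and singular system $\{\sigma_n;u_n,v_n\}_{n\in\mathbb{N}}$: $\{u_n\}$ is an orthonormal basis of $N(A)^\perp$, $\{v_n\}$ is an orthonormal basis of $\overline{R(A)}$, $\sigma_n>0$, $Au_n=\sigma_n v_n$, and $\sigma_n\to 0$ (singular values in decreasing order, each of multiplicity one). $\pi^*$ is a fixed probability distribution on $X$ with trace-class covariance operator, $\mathbb{E}_{x\sim\pi^*}[\|x\|^2]<\infty$, and $\Pi_n^* := \mathbb{E}_{x\sim\pi^*}[\langle x,u_n\rangle^2]$. In particular $\sum_n \Pi_n^*<\infty$, and it is assumed that $\Pi_n^*>0$ for all $n$. A noise distribution on $Y$ (resp. on $X$) is the law of a (possibly generalized, e.g. white-noise) random element $\epsilon$ of which only the coordinates $\langle\epsilon,v_n\rangle$ (resp. $\langle\epsilon,u_n\rangle$), square-integrable real random variables, are used. For $\nu$ on $Y$: $\Delta_n(\nu):=\mathbb{E}_{\epsilon\sim\nu}[\langle\epsilon,v_n\rangle^2]$ and $\boldsymbol{\delta}(\nu):=\sqrt{\sup_n\Delta_n(\nu)}$. For $\mu$ on $X$: $\tilde\Delta_n(\mu):=\mathbb{E}_{\epsilon\sim\mu}[\langle\epsilon,u_n\rangle^2]$ and $\boldsymbol{\delta}(\mu):=\sqrt{\sup_n\tilde\Delta_n(\mu)}$.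 For $t>0$ and a family $\Phi$ of noise distributions, $t\cdot\Phi$ denotes the set of laws of $t\epsilon$ with $\epsilon\sim\nu$, $\nu\in\Phi$ (so $\Delta_n$ is multiplied by $t^2$). The operators are, for $\mu$ on $X$ and $\nu$ on $Y$, $$R^{\mathrm{post}}_{\mu}y=\sum_{n\in\mathbb{N}}\frac{\sigma_n}{\sigma_n^2+\frac{\sigma_n^2\tilde\Delta_n(\mu)}{\Pi_n^*}}\langle y,v_n\rangle u_n,\qquad R^{\mathrm{mse}}_{\nu} y = \sum_{n\in\mathbb{N}} \frac{\sigma_n}{\sigma_n^2 + \frac{\Delta_n(\nu)}{\Pi_n^*}}\,\langle y, v_n\rangle u_n,$$ applied coefficientwise to noisy data: for $y=Ax+\epsilon$ one has $\langle y,v_n\rangle=\sigma_n\langle x,u_n\rangle+\langle\epsilon,v_n\rangle$, and $\|\cdot\|^2$ of an expansion in $\{u_n\}$ is the sum of the squared coefficients. Continuity means being a well-defined bounded linear operator on $Y$. *)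

theory Defs
  imports "HOL-Probability.Probability"
begin

text \<open>Hilbert spaces are types of sort \<open>{real_inner, complete_space}\<close>; separability is not assumed.\<close>

definition infinite_dimensional :: "'a::real_vector set \<Rightarrow> bool" where
  "infinite_dimensional S \<longleftrightarrow> (\<nexists>B. finite B \<and> S \<subseteq> span B)"

definition compact_operator :: "('a::real_normed_vector \<Rightarrow> 'b::real_normed_vector) \<Rightarrow> bool" where
  "compact_operator A \<longleftrightarrow> linear A \<and> (\<forall>S. bounded S \<longrightarrow> compact (closure (A ` S)))"

definition orthonormal_basis :: "'a::real_inner set \<Rightarrow> 'a set \<Rightarrow> bool" where
  "orthonormal_basis B S \<longleftrightarrow>
     (\<forall>x\<in>B. \<forall>y\<in>B. x \<bullet> y = (if x = y then 1 else 0)) \<and> closure (span B) = S"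

text \<open>Strict decrease of \<open>\<sigma>\<close> expresses that every singular value has multiplicity one.\<close>

definition singular_system ::
  "('a::real_inner \<Rightarrow> 'b::real_inner) \<Rightarrow> (nat \<Rightarrow> real) \<Rightarrow> (nat \<Rightarrow> 'a) \<Rightarrow> (nat \<Rightarrow> 'b) \<Rightarrow> bool" where
  "singular_system A \<sigma> u v \<longleftrightarrow>
     inj u \<and> orthonormal_basis (range u) (orthogonal_comp {z. A z = 0}) \<and>
     inj v \<and> orthonormal_basis (range v) (closure (range A)) \<and>
     (\<forall>n. 0 < \<sigma> n) \<and> (\<forall>n. A (u n) = \<sigma> n *\<^sub>R v n) \<and>
     (\<forall>n. \<sigma> (Suc n) < \<sigma> n) \<and> \<sigma> \<longlonglongrightarrow> 0"

definition covariance :: "'a::real_inner measure \<Rightarrow> 'a \<Rightarrow> 'a \<Rightarrow> real" where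
  "covariance P h k =
     (\<integral>x. (x \<bullet> h - (\<integral>z. z \<bullet> h \<partial>P)) * (x \<bullet> k - (\<integral>z. z \<bullet> k \<partial>P)) \<partial>P)"

text \<open>A covariance operator is positive and self-adjoint, so it is trace class exactly
  if the sums of its diagonal entries over orthonormal bases converge.\<close>

definition trace_class_covariance :: "'a::real_inner measure \<Rightarrow> bool" where
  "trace_class_covariance P \<longleftrightarrow>
     (\<exists>C. bounded_linear C \<and> (\<forall>h k. C h \<bullet> k = covariance P h k) \<and>
          (\<forall>B. orthonormal_basis B UNIV \<longrightarrow> (\<lambda>e. C e \<bullet> e) summable_on B))"

definition data_distribution :: "'a::real_inner measure \<Rightarrow> bool" where
  "data_distribution P \<longleftrightarrow>
     prob_space P \<and> sets P = sets borel \<and>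
     integrable P (\<lambda>x. (norm x)\<^sup>2) \<and> trace_class_covariance P"

definition data_var :: "'a::real_inner measure \<Rightarrow> (nat \<Rightarrow> 'a) \<Rightarrow> nat \<Rightarrow> real" where
  "data_var P u n = (\<integral>x. (x \<bullet> u n)\<^sup>2 \<partial>P)"

text \<open>A possibly generalized random element \<open>\<epsilon>\<close> (such as white noise) need not take values in the
  Hilbert space. Its law is represented by the joint law of its coordinate sequence, i.e. of
  \<open>\<langle>\<epsilon>, v n\<rangle>\<close> for noise on \<open>Y\<close> and of \<open>\<langle>\<epsilon>, u n\<rangle>\<close> for noise on \<open>X\<close>. Neither independence nor zero mean
  of the coordinates is required.\<close>

definition noise_law :: "(nat \<Rightarrow> real) measure \<Rightarrow> bool" where
  "noise_law \<nu> \<longleftrightarrow>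
     prob_space \<nu> \<and> sets \<nu> = sets (\<Pi>\<^sub>M n\<in>UNIV. borel) \<and>
     (\<forall>n. integrable \<nu> (\<lambda>\<epsilon>. (\<epsilon> n)\<^sup>2))"

definition noise_var :: "(nat \<Rightarrow> real) measure \<Rightarrow> nat \<Rightarrow> real" where
  "noise_var \<nu> n = (\<integral>\<epsilon>. (\<epsilon> n)\<^sup>2 \<partial>\<nu>)"

definition ennreal_sqrt :: "ennreal \<Rightarrow> ennreal" where
  "ennreal_sqrt a = (if a = \<infinity> then \<infinity> else ennreal (sqrt (enn2real a)))"

text \<open>The noise level is \<open>\<infinity>\<close> if the coordinate variances are unbounded.\<close>

definition noise_level :: "(nat \<Rightarrow> real) measure \<Rightarrow> ennreal" where
  "noise_level \<nu> = ennreal_sqrt (SUP n. ennreal (noise_var \<nu> n))"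

definition scale_noise :: "real \<Rightarrow> (nat \<Rightarrow> real) measure \<Rightarrow> (nat \<Rightarrow> real) measure" where
  "scale_noise t \<nu> = distr \<nu> (\<Pi>\<^sub>M n\<in>UNIV. borel) (\<lambda>\<epsilon> n. t * \<epsilon> n)"

definition noise_class :: "(nat \<Rightarrow> real) \<Rightarrow> real \<Rightarrow> (nat \<Rightarrow> real) measure set" where
  "noise_class l c = {\<nu>. noise_law \<nu> \<and> (\<forall>n. noise_var \<nu> n \<le> c * (l n)\<^sup>2)}"

definition post_coeff :: "(nat \<Rightarrow> real) \<Rightarrow> (nat \<Rightarrow> real) \<Rightarrow> (nat \<Rightarrow> real) measure \<Rightarrow> nat \<Rightarrow> real" where
  "post_coeff \<sigma> p \<mu> n = \<sigma> n / ((\<sigma> n)\<^sup>2 + (\<sigma> n)\<^sup>2 * noise_var \<mu> n / p n)"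

definition mse_coeff :: "(nat \<Rightarrow> real) \<Rightarrow> (nat \<Rightarrow> real) \<Rightarrow> (nat \<Rightarrow> real) measure \<Rightarrow> nat \<Rightarrow> real" where
  "mse_coeff \<sigma> p \<nu> n = \<sigma> n / ((\<sigma> n)\<^sup>2 + noise_var \<nu> n / p n)"

definition spectral_op ::
  "(nat \<Rightarrow> 'a::real_inner) \<Rightarrow> (nat \<Rightarrow> 'b::real_inner) \<Rightarrow> (nat \<Rightarrow> real) \<Rightarrow> 'b \<Rightarrow> 'a" where
  "spectral_op u v r y = (\<Sum>n. (r n * (y \<bullet> v n)) *\<^sub>R u n)"

definition continuous_spectral_op ::
  "(nat \<Rightarrow> 'a::real_inner) \<Rightarrow> (nat \<Rightarrow> 'b::real_inner) \<Rightarrow> (nat \<Rightarrow> real) \<Rightarrow> bool" where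
  "continuous_spectral_op u v r \<longleftrightarrow>
     (\<forall>y. summable (\<lambda>n. (r n * (y \<bullet> v n)) *\<^sub>R u n)) \<and> bounded_linear (spectral_op u v r)"

text \<open>Expected squared error of the operator with coefficients \<open>r\<close> on data \<open>A x + \<epsilon>\<close>. As \<open>\<epsilon>\<close> may lie
  outside \<open>Y\<close>, the operator acts coefficientwise, with \<open>\<langle>A x + \<epsilon>, v n\<rangle> = A x \<bullet> v n + \<epsilon> n\<close>, and the
  squared norm is the sum of the squared \<open>u n\<close>-coefficients (\<open>x\<close> lies in the closed span of the
  \<open>u n\<close>). The value may be \<open>\<infinity>\<close>.\<close>

definition expected_error ::
  "('a::real_inner \<Rightarrow> 'b::real_inner) \<Rightarrow> (nat \<Rightarrow> 'a) \<Rightarrow> (nat \<Rightarrow> 'b) \<Rightarrow> (nat \<Rightarrow> real) \<Rightarrow> 'a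
    \<Rightarrow> (nat \<Rightarrow> real) measure \<Rightarrow> ennreal" where
  "expected_error A u v r x \<nu> =
     (\<integral>\<^sup>+\<epsilon>. (\<Sum>n. ennreal ((r n * (A x \<bullet> v n + \<epsilon> n) - x \<bullet> u n)\<^sup>2)) \<partial>\<nu>)"

end

theory Submission
  imports Defs
begin

text \<open>
  In the singular bases the reconstruction acts on each coordinate separately. Write \<open>s = \<delta>\<^sup>2\<close>,
  \<open>p n\<close> for the data variances, \<open>D n \<le> s\<close> for the variances of the training noise and \<open>r n\<close> for
  the filter coefficients. Since \<open>r n * \<sigma> n = p n / (p n + D n)\<close>, the error in coordinate \<open>n\<close> is
  \<open>r n * \<epsilon> n - x n * (D n / (p n + D n))\<close>, the propagated noise minus a bias. The elementary bound \<open>(a + b)\<^sup>2 \<le> 2 * a\<^sup>2 + 2 * b\<^sup>2\<close> separates the two, also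
  for noise with nonzero mean.

  The squared bias is at most \<open>(x n)\<^sup>2 * (s / (p n + s))\<^sup>2\<close>. For the noise, the
  condition \<open>d * p n \<le> (\<sigma> n)\<^sup>2\<close> makes \<open>(r n)\<^sup>2 \<le> p n / (d * (p n + D n)\<^sup>2)\<close>. If \<open>D n \<ge> s * m n\<close> and
  the variances of the data noise are at most \<open>c * (s * m n)\<^sup>2\<close>, the propagated noise contributes at
  most \<open>c / d * p n * (s * m n / (p n + s * m n))\<^sup>2\<close>. The quadratic relation between the noise on
  the data and the training noise enters precisely here: it turns the noise term into a summable
  weight times the square of a factor that is at most 1.

  Both bounds are independent of the noise law, are dominated by multiples of \<open>(x n)\<^sup>2\<close> and \<open>p n\<close>, and
  tend to 0 for every fixed \<open>n\<close> as \<open>s\<close> tends to 0. Bessel's inequality makes \<open>(x n)\<^sup>2\<close> and \<open>p n\<close>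
  summable, so Tannery's theorem gives convergence of the sums, uniformly in the noise law. The two
  claims are the cases \<open>m = l\<close> and, for white training noise, \<open>m = 1\<close>, \<open>c = 1\<close>.
\<close>

section \<open>Bessel's inequality and the data variances\<close>

lemma bessel_inequality_lessThan:
  fixes u :: "nat \<Rightarrow> 'a::real_inner"
  assumes ortho: "\<And>i j. u i \<bullet> u j = (if i = j then 1 else 0)"
  shows "(\<Sum>n<N. (x \<bullet> u n)\<^sup>2) \<le> (norm x)\<^sup>2"
proof -
  define w where "w = (\<Sum>n<N. (x \<bullet> u n) *\<^sub>R u n)"
  have xw: "x \<bullet> w = (\<Sum>n<N. (x \<bullet> u n)\<^sup>2)"
    by (simp add: w_def inner_sum_right power2_eq_square)
  have uw: "u n \<bullet> w = x \<bullet> u n" if "n < N" for n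
    using that by (simp add: w_def inner_sum_right ortho if_distrib cong: if_cong)
  have ww: "w \<bullet> w = (\<Sum>n<N. (x \<bullet> u n)\<^sup>2)"
  proof -
    have "w \<bullet> w = (\<Sum>n<N. (x \<bullet> u n) * (u n \<bullet> w))"
      by (subst (1) w_def) (simp add: inner_sum_left)
    also have "\<dots> = (\<Sum>n<N. (x \<bullet> u n)\<^sup>2)"
      by (intro sum.cong) (auto simp: uw power2_eq_square)
    finally show ?thesis .
  qed
  \<comment> \<open>\<open>w\<close> is the projection of \<open>x\<close> onto the span of the first \<open>N\<close> vectors.\<close>
  have "0 \<le> (x - w) \<bullet> (x - w)" by simp
  also have "\<dots> = (norm x)\<^sup>2 - (\<Sum>n<N. (x \<bullet> u n)\<^sup>2)"
    by (simp add: inner_diff_left inner_diff_right xw ww inner_commute[of w x] power2_norm_eq_inner)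
  finally show ?thesis by simp
qed

lemma summable_square_coefficients:
  fixes u :: "nat \<Rightarrow> 'a::real_inner"
  assumes "\<And>i j. u i \<bullet> u j = (if i = j then 1 else 0)"
  shows "summable (\<lambda>n. (x \<bullet> u n)\<^sup>2)"
  by (rule summableI_nonneg_bounded) (use bessel_inequality_lessThan[of u, OF assms] in auto)

text \<open>Integrating Bessel's inequality bounds every partial sum by the second moment of \<open>P\<close>.\<close>

lemma summable_data_var:
  fixes u :: "nat \<Rightarrow> 'a::real_inner"
  assumes ortho: "\<And>i j. u i \<bullet> u j = (if i = j then 1 else 0)"
    and P: "data_distribution P"
  shows "summable (data_var P u)"
proof -
  have sets[measurable_cong]: "sets P = sets borel" and int: "integrable P (\<lambda>x. (norm x)\<^sup>2)"
    using P by (auto simp: data_distribution_def)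
  have meas: "(\<lambda>x. (x \<bullet> u n)\<^sup>2) \<in> borel_measurable P" for n
  proof -
    have "(\<lambda>x. (x \<bullet> u n)\<^sup>2) \<in> borel_measurable borel"
      by (intro borel_measurable_continuous_onI continuous_intros)
    thus ?thesis using sets by (simp cong: measurable_cong_sets)
  qed
  have norm_u: "norm (u n) = 1" for n
    by (simp add: norm_eq_sqrt_inner ortho)
  have int_coeff: "integrable P (\<lambda>x. (x \<bullet> u n)\<^sup>2)" for n
  proof (rule Bochner_Integration.integrable_bound[OF int meas], rule AE_I2)
    fix x
    have "\<bar>x \<bullet> u n\<bar> \<le> norm x" using Cauchy_Schwarz_ineq2[of x "u n"] by (simp add: norm_u)
    thus "norm ((x \<bullet> u n)\<^sup>2) \<le> norm ((norm x)\<^sup>2)"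
      using abs_le_square_iff[of "x \<bullet> u n" "norm x"] by simp
  qed
  show ?thesis
  proof (rule summableI_nonneg_bounded)
    show "0 \<le> data_var P u n" for n by (simp add: data_var_def)
    fix N
    have "(\<Sum>n<N. data_var P u n) = (\<integral>x. (\<Sum>n<N. (x \<bullet> u n)\<^sup>2) \<partial>P)"
      by (simp add: data_var_def int_coeff)
    also have "\<dots> \<le> (\<integral>x. (norm x)\<^sup>2 \<partial>P)"
      using int int_coeff bessel_inequality_lessThan[OF ortho] by (intro integral_mono) auto
    finally show "(\<Sum>n<N. data_var P u n) \<le> (\<integral>x. (norm x)\<^sup>2 \<partial>P)" .
  qed
qed

section \<open>Diagonalisation by the singular system\<close>

lemma compact_operator_bounded_linear:
  assumes "compact_operator A"
  shows "bounded_linear A"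
proof -
  interpret linear A using assms by (simp add: compact_operator_def)
  have "bounded (A ` cball 0 1)"
    using assms unfolding compact_operator_def
    by (meson bounded_cball bounded_subset closure_subset compact_imp_bounded)
  then obtain K where "\<forall>y \<in> A ` cball 0 1. norm y \<le> K"
    by (auto simp: bounded_iff simp del: image_iff)
  hence K: "norm (A z) \<le> K" if "norm z \<le> 1" for z
    using that by simp
  show ?thesis
  proof (rule bounded_linear_intro)
    fix x
    show "norm (A x) \<le> norm x * K"
    proof (cases "x = 0")
      case False
      have "norm (A (inverse (norm x) *\<^sub>R x)) \<le> K" using False by (intro K) simp
      hence "inverse (norm x) * norm (A x) \<le> K" by (simp add: scale)
      thus ?thesis using False by (simp add: field_simps)
    qed (simp add: zero)
  qed (simp_all add: add scale)
qed

text \<open>Both sides are continuous and linear in \<open>x\<close> and agree on every \<open>u m\<close>.\<close>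

lemma singular_system_inner:
  assumes A: "bounded_linear A" and S: "singular_system A \<sigma> u v"
    and x: "x \<in> orthogonal_comp {z. A z = 0}"
  shows "A x \<bullet> v n = \<sigma> n * (x \<bullet> u n)"
proof -
  interpret A: bounded_linear A by fact
  have u: "u i \<bullet> u j = (if i = j then 1 else 0)" and v: "v i \<bullet> v j = (if i = j then 1 else 0)"
    and Au: "A (u j) = \<sigma> j *\<^sub>R v j" for i j
    using S by (auto simp: singular_system_def orthonormal_basis_def inj_def)
  define E where "E = {z. A z \<bullet> v n = \<sigma> n * (z \<bullet> u n)}"
  have "subspace E"
    by (auto simp: E_def subspace_def A.add A.scale A.zero inner_add_left distrib_left)
  moreover have "range u \<subseteq> E" by (auto simp: E_def Au u v)
  ultimately have "span (range u) \<subseteq> E" by (intro span_minimal)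
  moreover have "closed E"
    unfolding E_def by (intro closed_Collect_eq continuous_intros A.continuous_on)
  ultimately have "closure (span (range u)) \<subseteq> E" by (intro closure_minimal)
  thus ?thesis
    using x S by (auto simp: singular_system_def orthonormal_basis_def E_def)
qed

section \<open>Variances of noise laws\<close>

lemma noise_var_nonneg: "0 \<le> noise_var \<nu> n"
  by (simp add: noise_var_def)

lemma ennreal_sqrt_le_ennrealD:
  assumes "ennreal_sqrt a \<le> ennreal t" and "0 \<le> t"
  shows "a \<le> ennreal (t\<^sup>2)"
proof (cases a)
  case (real b)
  hence "sqrt b \<le> t" using assms by (simp add: ennreal_sqrt_def)
  hence "b \<le> t\<^sup>2" using real by (simp add: sqrt_le_D)
  thus ?thesis using real by (simp add: ennreal_leI)
next
  case top
  thus ?thesis using assms by (simp add: ennreal_sqrt_def top_unique)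
qed

lemma noise_var_le_of_noise_level:
  assumes "noise_level \<nu> \<le> ennreal t" and "0 \<le> t"
  shows "noise_var \<nu> n \<le> t\<^sup>2"
proof -
  have "ennreal (noise_var \<nu> n) \<le> (SUP n. ennreal (noise_var \<nu> n))" by (rule SUP_upper) simp
  also have "\<dots> \<le> ennreal (t\<^sup>2)"
    using ennreal_sqrt_le_ennrealD assms by (simp add: noise_level_def)
  finally show ?thesis by simp
qed

lemma noise_law_borel_measurable:
  assumes "noise_law \<nu>"
  shows "(\<lambda>\<epsilon>. \<epsilon> n) \<in> borel_measurable \<nu>"
proof -
  have "sets \<nu> = sets (\<Pi>\<^sub>M n\<in>UNIV. borel)" using assms by (simp add: noise_law_def)
  hence "measurable \<nu> borel = measurable (\<Pi>\<^sub>M n\<in>UNIV. borel) (borel :: real measure)"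
    by (intro measurable_cong_sets) auto
  thus ?thesis by (simp add: measurable_component_singleton)
qed

lemma
  assumes "noise_law \<nu>"
  shows noise_law_scale_noise: "noise_law (scale_noise t \<nu>)"
    and noise_var_scale_noise: "noise_var (scale_noise t \<nu>) n = t\<^sup>2 * noise_var \<nu> n"
proof -
  have m: "(\<lambda>\<epsilon> n. t * \<epsilon> n) \<in> measurable \<nu> (\<Pi>\<^sub>M n\<in>UNIV. borel)"
    by (rule measurable_PiM_single')
       (auto intro!: borel_measurable_times noise_law_borel_measurable[OF assms])
  have sq: "(\<lambda>\<epsilon>. (\<epsilon> n)\<^sup>2) \<in> borel_measurable (\<Pi>\<^sub>M n\<in>UNIV. borel :: real measure)" for n :: nat
    by measurable
  interpret prob_space \<nu> using assms by (simp add: noise_law_def)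
  show "noise_law (scale_noise t \<nu>)"
    unfolding noise_law_def scale_noise_def
    using assms by (auto simp: integrable_distr_eq[OF m sq] power_mult_distrib noise_law_def
        intro!: prob_space_distr m)
  show "noise_var (scale_noise t \<nu>) n = t\<^sup>2 * noise_var \<nu> n"
    by (simp add: noise_var_def scale_noise_def integral_distr[OF m sq] power_mult_distrib)
qed

lemma nn_integral_affine_square_le:
  assumes \<nu>: "noise_law \<nu>"
  shows "(\<integral>\<^sup>+\<epsilon>. ennreal ((b + r * \<epsilon> n)\<^sup>2) \<partial>\<nu>) \<le> ennreal (2 * b\<^sup>2 + 2 * (r\<^sup>2 * noise_var \<nu> n))"
proof -
  interpret prob_space \<nu> using \<nu> by (simp add: noise_law_def)
  have int: "integrable \<nu> (\<lambda>\<epsilon>. (\<epsilon> n)\<^sup>2)" using \<nu> by (simp add: noise_law_def)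
  have "(b + r * e)\<^sup>2 \<le> 2 * b\<^sup>2 + 2 * r\<^sup>2 * e\<^sup>2" for e
  proof -
    have "2 * b\<^sup>2 + 2 * r\<^sup>2 * e\<^sup>2 - (b + r * e)\<^sup>2 = (b - r * e)\<^sup>2"
      by (simp add: power2_eq_square algebra_simps)
    thus ?thesis using zero_le_power2[of "b - r * e"] by linarith
  qed
  hence "(\<integral>\<^sup>+\<epsilon>. ennreal ((b + r * \<epsilon> n)\<^sup>2) \<partial>\<nu>) \<le> (\<integral>\<^sup>+\<epsilon>. ennreal (2 * b\<^sup>2 + 2 * r\<^sup>2 * (\<epsilon> n)\<^sup>2) \<partial>\<nu>)"
    by (intro nn_integral_mono ennreal_leI) auto
  also have "\<dots> = ennreal (\<integral>\<epsilon>. 2 * b\<^sup>2 + 2 * r\<^sup>2 * (\<epsilon> n)\<^sup>2 \<partial>\<nu>)"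
    using int by (intro nn_integral_eq_integral) auto
  also have "(\<integral>\<epsilon>. 2 * b\<^sup>2 + 2 * r\<^sup>2 * (\<epsilon> n)\<^sup>2 \<partial>\<nu>) = 2 * b\<^sup>2 + 2 * (r\<^sup>2 * noise_var \<nu> n)"
    using int by (simp add: noise_var_def prob_space)
  finally show ?thesis .
qed

section \<open>A bound for the error that is uniform in the noise law\<close>

text \<open>In the definition, \<open>a\<close> stands for \<open>x n\<close>, \<open>p\<close> for the data variance, \<open>k\<close> for \<open>c / d\<close>, \<open>m\<close> for
  the relative lower bound of the training noise, and \<open>s\<close> for the squared training noise level.\<close>

definition error_envelope :: "real \<Rightarrow> real \<Rightarrow> real \<Rightarrow> real \<Rightarrow> real \<Rightarrow> real" where
  "error_envelope a p k m s = 2 * (a\<^sup>2 * (s / (p + s))\<^sup>2) + 2 * (k * p * (s * m / (p + s * m))\<^sup>2)"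

lemma error_envelope_nonneg: "0 \<le> p \<Longrightarrow> 0 \<le> k \<Longrightarrow> 0 \<le> error_envelope a p k m s"
  by (simp add: error_envelope_def)

lemma error_envelope_le:
  assumes "0 < p" "0 \<le> k" "0 \<le> m" "0 \<le> s"
  shows "error_envelope a p k m s \<le> 2 * a\<^sup>2 + 2 * (k * p)"
proof -
  have frac: "(t / (p + t))\<^sup>2 \<le> 1" if "0 \<le> t" for t
    using that assms by (intro power_le_one) auto
  have "a\<^sup>2 * (s / (p + s))\<^sup>2 \<le> a\<^sup>2"
    using frac assms by (intro mult_left_le) auto
  moreover have "k * p * (s * m / (p + s * m))\<^sup>2 \<le> k * p"
    using frac[of "s * m"] assms by (intro mult_left_le) auto
  ultimately show ?thesis by (simp add: error_envelope_def)
qed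

lemma error_envelope_tendsto_0:
  assumes "0 < p"
  shows "((\<lambda>s. error_envelope a p k m s) \<longlongrightarrow> 0) (at 0)"
proof -
  have "((\<lambda>s. error_envelope a p k m s) \<longlongrightarrow> 
    2 * (a\<^sup>2 * (0 / (p + 0))\<^sup>2) + 2 * (k * p * (0 * m / (p + 0 * m))\<^sup>2)) (at 0)"
    unfolding error_envelope_def using assms by (intro tendsto_intros) auto
  thus ?thesis by simp
qed

lemma suminf_error_envelope_tendsto_0:
  fixes a p m :: "nat \<Rightarrow> real"
  assumes a: "summable (\<lambda>n. (a n)\<^sup>2)" and p: "summable p" "\<And>n. 0 < p n"
    and k: "0 \<le> k" and m: "\<And>n. 0 \<le> m n"
  shows "((\<lambda>s. \<Sum>n. error_envelope (a n) (p n) k (m n) s) \<longlongrightarrow> 0) (at_right 0)"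
proof -
  have "eventually (\<lambda>(n, s). norm (error_envelope (a n) (p n) k (m n) s) \<le> 2 * (a n)\<^sup>2 + 2 * (k * p n))
      (sequentially \<times>\<^sub>F at_right 0)"
    unfolding eventually_prod_filter
  proof (intro exI conjI allI impI)
    show "eventually (\<lambda>n::nat. True) sequentially" by simp
    show "eventually (\<lambda>s::real. 0 < s) (at_right 0)" by (rule eventually_at_right_less)
    fix n :: nat and s :: real
    assume "0 < s"
    thus "case (n, s) of (n, s) \<Rightarrow>
        norm (error_envelope (a n) (p n) k (m n) s) \<le> 2 * (a n)\<^sup>2 + 2 * (k * p n)"
      using error_envelope_le[of "p n" k "m n" s "a n"] error_envelope_nonneg[of "p n" k] p(2)[of n] k m
      by simp
  qed
  hence "((\<lambda>s. \<Sum>n. error_envelope (a n) (p n) k (m n) s) \<longlongrightarrow> (\<Sum>n. 0)) (at_right 0)"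
  proof (intro tannerys_theorem[THEN conjunct2, THEN conjunct2])
    show "((\<lambda>s. error_envelope (a n) (p n) k (m n) s) \<longlongrightarrow> 0) (at_right 0)" for n
      using error_envelope_tendsto_0[OF p(2)] by (rule filterlim_mono) (simp_all add: at_le)
    show "summable (\<lambda>n. 2 * (a n)\<^sup>2 + 2 * (k * p n))"
      using a p by (intro summable_add summable_mult)
  qed simp_all
  thus ?thesis by simp
qed

text \<open>The bias increases with the training noise, hence is bounded through \<open>D \<le> s\<close>, while the
  propagated noise decreases with it and is bounded through \<open>s * m \<le> D\<close>. The assumption
  \<open>d * p \<le> \<sigma>\<^sup>2\<close> absorbs the factor \<open>1 / \<sigma>\<^sup>2\<close> of \<open>r\<^sup>2\<close>, at the price of one of the two factors \<open>p\<close>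
  in its numerator; the factor \<open>p\<close> that is left makes the noise terms summable over the
  coordinates.\<close>

lemma coordinate_error_le_envelope:
  assumes p: "0 < p" and sg: "0 < \<sigma>" and d: "0 < d" "d * p \<le> \<sigma>\<^sup>2"
    and s: "0 \<le> s" and m: "0 \<le> m" and D: "s * m \<le> D" "D \<le> s"
    and q: "0 \<le> q" "q \<le> c * (s * m)\<^sup>2"
    and r: "r = \<sigma> / (\<sigma>\<^sup>2 + \<sigma>\<^sup>2 * D / p)"
  shows "2 * (r * (\<sigma> * a) - a)\<^sup>2 + 2 * (r\<^sup>2 * q) \<le> error_envelope a p (c / d) m s"
proof -
  have sm: "0 \<le> s * m" using s m by simp
  have pos: "0 < p + D" "0 < p + s * m" "0 < p + s" using p sm D s by linarith+
  have r': "r = p / (\<sigma> * (p + D))"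
  proof -
    have "\<sigma>\<^sup>2 + \<sigma>\<^sup>2 * D / p = \<sigma> * (\<sigma> * (p + D)) / p"
      using p by (simp add: field_simps power2_eq_square)
    thus ?thesis using sg unfolding r by simp
  qed
  have bias_eq: "r * (\<sigma> * a) - a = - (a * (D / (p + D)))"
  proof -
    have "r * (\<sigma> * a) = a * p / (p + D)" using sg by (simp add: r')
    thus ?thesis using pos by (simp add: field_simps)
  qed
  have "D / (p + D) \<le> s / (p + s)"
    using D p pos by (simp add: field_simps)
  hence "(D / (p + D))\<^sup>2 \<le> (s / (p + s))\<^sup>2"
    using D sm pos by (intro power_mono) auto
  hence bias: "(r * (\<sigma> * a) - a)\<^sup>2 \<le> a\<^sup>2 * (s / (p + s))\<^sup>2"
    unfolding bias_eq power2_minus power_mult_distrib by (rule mult_left_mono) simp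
  have "r\<^sup>2 = p\<^sup>2 / (\<sigma>\<^sup>2 * (p + D)\<^sup>2)"
    by (simp add: r' power_divide power_mult_distrib)
  also have "\<dots> \<le> p\<^sup>2 / ((d * p) * (p + s * m)\<^sup>2)"
    using d p sg D sm pos by (intro divide_left_mono mult_mono power_mono mult_pos_pos) auto
  also have "\<dots> = p / (d * (p + s * m)\<^sup>2)"
    using p by (simp add: power2_eq_square)
  finally have "r\<^sup>2 * q \<le> p / (d * (p + s * m)\<^sup>2) * (c * (s * m)\<^sup>2)"
    using q p d by (intro mult_mono) auto
  also have "\<dots> = c / d * p * (s * m / (p + s * m))\<^sup>2"
    by (simp add: power_divide)
  finally show ?thesis using bias by (simp add: error_envelope_def)
qed

text \<open>Expectation and the sum over the coordinates commute by nonnegativity, so only the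
  second moments of the single noise coordinates enter the bound.\<close>

lemma expected_error_le_envelope:
  fixes u :: "nat \<Rightarrow> 'x::real_inner" and v :: "nat \<Rightarrow> 'y::real_inner"
  assumes Ax: "\<And>n. A x \<bullet> v n = \<sigma> n * (x \<bullet> u n)"
    and x: "summable (\<lambda>n. (x \<bullet> u n)\<^sup>2)" and p: "summable p" "\<And>n. 0 < p n"
    and sg: "\<And>n. 0 < \<sigma> n" and d: "0 < d" "\<And>n. d * p n \<le> (\<sigma> n)\<^sup>2"
    and s: "0 \<le> s" and m: "\<And>n. 0 \<le> m n"
    and D: "\<And>n. s * m n \<le> noise_var \<mu> n" "\<And>n. noise_var \<mu> n \<le> s"
    and c: "0 \<le> c" and \<nu>: "noise_law \<nu>" "\<And>n. noise_var \<nu> n \<le> c * (s * m n)\<^sup>2"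
  shows "expected_error A u v (post_coeff \<sigma> p \<mu>) x \<nu>
    \<le> ennreal (\<Sum>n. error_envelope (x \<bullet> u n) (p n) (c / d) (m n) s)"
proof -
  let ?r = "post_coeff \<sigma> p \<mu>"
  let ?g = "\<lambda>n. error_envelope (x \<bullet> u n) (p n) (c / d) (m n) s"
  have g0: "0 \<le> ?g n" for n using p(2)[of n] c d by (intro error_envelope_nonneg) auto
  have g: "summable ?g"
  proof (rule summable_comparison_test')
    show "summable (\<lambda>n. 2 * (x \<bullet> u n)\<^sup>2 + 2 * (c / d * p n))"
      using x p by (intro summable_add summable_mult)
    show "norm (?g n) \<le> 2 * (x \<bullet> u n)\<^sup>2 + 2 * (c / d * p n)" for n
      using error_envelope_le[of "p n" "c / d" "m n" s "x \<bullet> u n"] p c d s m g0[of n] by simp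
  qed
  note noise_law_borel_measurable[OF \<nu>(1), measurable]
  have "expected_error A u v ?r x \<nu>
      = (\<Sum>n. \<integral>\<^sup>+\<epsilon>. ennreal ((?r n * (A x \<bullet> v n + \<epsilon> n) - x \<bullet> u n)\<^sup>2) \<partial>\<nu>)"
    unfolding expected_error_def by (rule nn_integral_suminf) measurable
  also have "\<dots> \<le> (\<Sum>n. ennreal (?g n))"
  proof (rule suminf_le)
    fix n
    define b where "b = ?r n * (\<sigma> n * (x \<bullet> u n)) - x \<bullet> u n"
    have "?r n * (A x \<bullet> v n + e) - x \<bullet> u n = b + ?r n * e" for e
      by (simp add: b_def Ax algebra_simps)
    hence "(\<integral>\<^sup>+\<epsilon>. ennreal ((?r n * (A x \<bullet> v n + \<epsilon> n) - x \<bullet> u n)\<^sup>2) \<partial>\<nu>)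
        = (\<integral>\<^sup>+\<epsilon>. ennreal ((b + ?r n * \<epsilon> n)\<^sup>2) \<partial>\<nu>)" by simp
    also have "\<dots> \<le> ennreal (2 * b\<^sup>2 + 2 * ((?r n)\<^sup>2 * noise_var \<nu> n))"
      by (rule nn_integral_affine_square_le[OF \<nu>(1)])
    also have "\<dots> \<le> ennreal (?g n)"
      unfolding b_def
      by (intro ennreal_leI coordinate_error_le_envelope[where D = "noise_var \<mu> n"])
         (use p sg d s m D \<nu> noise_var_nonneg in \<open>auto simp: post_coeff_def\<close>)
    finally show "(\<integral>\<^sup>+\<epsilon>. ennreal ((?r n * (A x \<bullet> v n + \<epsilon> n) - x \<bullet> u n)\<^sup>2) \<partial>\<nu>) \<le> ennreal (?g n)" .
  qed simp_all
  also have "\<dots> = ennreal (\<Sum>n. ?g n)" using g0 g by (rule suminf_ennreal2)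
  finally show ?thesis .
qed

section \<open>Convergence\<close>

text \<open>Both claims of the theorem are instances: the noise on the data only has to be at most
  quadratic in the lower bound \<open>\<delta>\<^sup>2 * m n\<close> of the training variances.\<close>

lemma worst_case_error_tendsto_0:
  fixes u :: "nat \<Rightarrow> 'x::real_inner" and v :: "nat \<Rightarrow> 'y::real_inner"
  assumes Ax: "\<And>n. A x \<bullet> v n = \<sigma> n * (x \<bullet> u n)"
    and x: "summable (\<lambda>n. (x \<bullet> u n)\<^sup>2)" and p: "summable p" "\<And>n. 0 < p n"
    and sg: "\<And>n. 0 < \<sigma> n" and d: "0 < d" "\<And>n. d * p n \<le> (\<sigma> n)\<^sup>2"
    and m: "\<And>n. 0 \<le> m n"
    and D: "\<And>\<delta> n. 0 < \<delta> \<Longrightarrow> \<delta>\<^sup>2 * m n \<le> noise_var (\<mu> \<delta>) n"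
      "\<And>\<delta> n. 0 < \<delta> \<Longrightarrow> noise_var (\<mu> \<delta>) n \<le> \<delta>\<^sup>2"
    and c: "0 \<le> c"
    and N: "\<And>\<delta> \<nu>. 0 < \<delta> \<Longrightarrow> \<nu> \<in> N \<delta> \<Longrightarrow> noise_law \<nu>"
      "\<And>\<delta> \<nu> n. 0 < \<delta> \<Longrightarrow> \<nu> \<in> N \<delta> \<Longrightarrow> noise_var \<nu> n \<le> c * (\<delta>\<^sup>2 * m n)\<^sup>2"
  shows "((\<lambda>\<delta>. SUP \<nu> \<in> N \<delta>. expected_error A u v (post_coeff \<sigma> p (\<mu> \<delta>)) x \<nu>) \<longlongrightarrow> 0)
    (at_right 0)"
proof (rule tendsto_sandwich[where f = "\<lambda>_. 0"])
  let ?G = "\<lambda>s. \<Sum>n. error_envelope (x \<bullet> u n) (p n) (c / d) (m n) s"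
  have "filterlim (\<lambda>\<delta>::real. \<delta>\<^sup>2) (at_right 0) (at_right 0)"
    by real_asymp
  from filterlim_compose[OF suminf_error_envelope_tendsto_0 this]
  have "((\<lambda>\<delta>. ?G (\<delta>\<^sup>2)) \<longlongrightarrow> 0) (at_right 0)"
    using x p m c d by simp
  from tendsto_ennrealI[OF this]
  show "((\<lambda>\<delta>. ennreal (?G (\<delta>\<^sup>2))) \<longlongrightarrow> 0) (at_right 0)" by simp
  have "(SUP \<nu> \<in> N \<delta>. expected_error A u v (post_coeff \<sigma> p (\<mu> \<delta>)) x \<nu>) \<le> ennreal (?G (\<delta>\<^sup>2))"
    if "0 < \<delta>" for \<delta>
    using that assms by (intro SUP_least expected_error_le_envelope) auto
  thus "\<forall>\<^sub>F \<delta> in at_right 0.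
      (SUP \<nu> \<in> N \<delta>. expected_error A u v (post_coeff \<sigma> p (\<mu> \<delta>)) x \<nu>) \<le> ennreal (?G (\<delta>\<^sup>2))"
    by (auto simp: eventually_at_right_less intro: eventually_mono[OF eventually_at_right_less])
qed simp_all

theorem theorem3:
  fixes A :: "'x::{real_inner, complete_space} \<Rightarrow> 'y::{real_inner, complete_space}"
    and \<sigma> :: "nat \<Rightarrow> real" and u :: "nat \<Rightarrow> 'x" and v :: "nat \<Rightarrow> 'y"
    and P :: "'x measure" and d :: real
    and \<mu> :: "real \<Rightarrow> (nat \<Rightarrow> real) measure" and l :: "nat \<Rightarrow> real"
  assumes "infinite_dimensional (UNIV :: 'x set)" and "infinite_dimensional (UNIV :: 'y set)"
    and "compact_operator A" and "infinite_dimensional (range A)"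
    and "singular_system A \<sigma> u v"
    and "data_distribution P" and "\<And>n. data_var P u n > 0"
    and "d > 0" and "\<And>n. d * data_var P u n \<le> (\<sigma> n)\<^sup>2"
    and "\<And>\<delta>. \<delta> > 0 \<Longrightarrow> noise_law (\<mu> \<delta>)"
    and "\<And>\<delta>. \<delta> > 0 \<Longrightarrow> continuous_spectral_op u v (post_coeff \<sigma> (data_var P u) (\<mu> \<delta>))"
    and "\<And>\<delta>. \<delta> > 0 \<Longrightarrow> noise_level (\<mu> \<delta>) = ennreal \<delta>"
    and "\<And>n. l n \<ge> 0"
    and "\<And>\<delta> n. \<delta> > 0 \<Longrightarrow> noise_var (\<mu> \<delta>) n \<ge> \<delta>\<^sup>2 * l n"
  shows "(\<forall>x \<in> orthogonal_comp {z. A z = 0}. \<forall>c>0.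
            ((\<lambda>\<delta>. SUP \<nu> \<in> scale_noise (\<delta>\<^sup>2) ` noise_class l c.
                expected_error A u v (post_coeff \<sigma> (data_var P u) (\<mu> \<delta>)) x \<nu>)
              \<longlongrightarrow> 0) (at_right 0))
       \<and> ((\<forall>\<delta>>0. \<forall>n. noise_var (\<mu> \<delta>) n = \<delta>\<^sup>2) \<longrightarrow>
          (\<forall>x \<in> orthogonal_comp {z. A z = 0}.
            ((\<lambda>\<delta>. SUP \<nu> \<in> {\<nu>. noise_law \<nu>
                  \<and> continuous_spectral_op u v (mse_coeff \<sigma> (data_var P u) \<nu>)
                  \<and> noise_level \<nu> \<le> ennreal (\<delta>\<^sup>2)}.
                expected_error A u v (post_coeff \<sigma> (data_var P u) (\<mu> \<delta>)) x \<nu>)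
              \<longlongrightarrow> 0) (at_right 0)))"
proof -
  define p where "p = data_var P u"
  have ortho: "u i \<bullet> u j = (if i = j then 1 else 0)" and sg: "0 < \<sigma> j" for i j
    using assms(5) by (auto simp: singular_system_def orthonormal_basis_def inj_def)
  have p: "summable p" "\<And>n. 0 < p n"
    using summable_data_var[OF ortho assms(6)] assms(7) by (auto simp: p_def)
  have d: "0 < d" "\<And>n. d * p n \<le> (\<sigma> n)\<^sup>2" using assms(8,9) by (auto simp: p_def)
  have Ax: "A x \<bullet> v n = \<sigma> n * (x \<bullet> u n)" if "x \<in> orthogonal_comp {z. A z = 0}" for x n
    using singular_system_inner[OF compact_operator_bounded_linear] assms(3,5) that by blast
  have x: "summable (\<lambda>n. (x \<bullet> u n)\<^sup>2)" for x
    by (rule summable_square_coefficients[OF ortho])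
  have D: "noise_var (\<mu> \<delta>) n \<le> \<delta>\<^sup>2" if "0 < \<delta>" for \<delta> n
    using noise_var_le_of_noise_level[of "\<mu> \<delta>" \<delta>] assms(12) that by simp
  show ?thesis
    unfolding p_def[symmetric]
  proof (intro conjI ballI allI impI)
    fix x and c :: real
    assume X: "x \<in> orthogonal_comp {z. A z = 0}" and c: "0 < c"
    show "((\<lambda>\<delta>. SUP \<nu> \<in> scale_noise (\<delta>\<^sup>2) ` noise_class l c.
        expected_error A u v (post_coeff \<sigma> p (\<mu> \<delta>)) x \<nu>) \<longlongrightarrow> 0) (at_right 0)"
    proof (rule worst_case_error_tendsto_0[where m = l and c = c and d = d])
      fix \<delta> :: real and \<nu> n
      assume "\<nu> \<in> scale_noise (\<delta>\<^sup>2) ` noise_class l c"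
      then obtain \<nu>' where \<nu>: "\<nu> = scale_noise (\<delta>\<^sup>2) \<nu>'" "noise_law \<nu>'" "noise_var \<nu>' n \<le> c * (l n)\<^sup>2"
        by (auto simp: noise_class_def)
      show "noise_law \<nu>" using \<nu> by (simp add: noise_law_scale_noise)
      show "noise_var \<nu> n \<le> c * (\<delta>\<^sup>2 * l n)\<^sup>2"
        using mult_left_mono[OF \<nu>(3), of "(\<delta>\<^sup>2)\<^sup>2"]
        by (simp add: \<nu> noise_var_scale_noise power_mult_distrib mult_ac)
    qed (use X Ax x p sg d D c assms(13,14) in auto)
  next
    fix x
    assume white: "\<forall>\<delta>>0. \<forall>n. noise_var (\<mu> \<delta>) n = \<delta>\<^sup>2" and X: "x \<in> orthogonal_comp {z. A z = 0}"
    show "((\<lambda>\<delta>. SUP \<nu> \<in> {\<nu>. noise_law \<nu> \<and> continuous_spectral_op u v (mse_coeff \<sigma> p \<nu>)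
          \<and> noise_level \<nu> \<le> ennreal (\<delta>\<^sup>2)}.
        expected_error A u v (post_coeff \<sigma> p (\<mu> \<delta>)) x \<nu>) \<longlongrightarrow> 0) (at_right 0)"
      by (rule worst_case_error_tendsto_0[where m = "\<lambda>_. 1" and c = 1 and d = d])
         (use X Ax x p sg d white noise_var_le_of_noise_level[of _ "\<delta>\<^sup>2" for \<delta>] in auto)
  qed
qed

end
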